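(* For every $\varepsilon>0$ there exist $\eta=\eta(\varepsilon)>0$ and a constant $C=C(\varepsilon)>0$ such that for every odd squarefree integer $q>1$ all of whose prime factors are at most $q^{\eta}$, there exists an integer $a$ with $1\le a\le C q^{\varepsilon}$, $(a,q)=1$ and $2\nmid a+\bar a$.
   Context: For an odd integer $q>1$ and $a\in\mathbf{Z}$ with $(a,q)=1$, $\bar a$ denotes the unique integer with $1\le \bar a\le q-1$ and $a\bar a\equiv 1 \pmod q$. *)

theory Defs
  imports Complex_Main "HOL-Number_Theory.Number_Theory" "HOL-Computational_Algebra.Squarefree"
begin

text \<open>
  The inverse of \<open>a\<close> modulo \<open>q\<close>, taken in the range from \<open>1\<close> to \<open>q - 1\<close>.
  It is meaningful only for \<open>q > 1\<close> and \<open>a\<close> coprime to \<open>q\<close>; \<open>a\<close> itself may exceed \<open>q\<close>.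
\<close>

definition inv_residue :: "int \<Rightarrow> int \<Rightarrow> int" where
  "inv_residue q a = (THE b. 1 \<le> b \<and> b \<le> q - 1 \<and> [a * b = 1] (mod q))"

lemma inv_residue_unique_existence:
  fixes q a :: int
  assumes "q > 1" and "coprime a q"
  shows "\<exists>!b. 1 \<le> b \<and> b \<le> q - 1 \<and> [a * b = 1] (mod q)"
proof -
  obtain x where x: "[a * x = 1] (mod q)"
    using assms(2) cong_solve_coprime_int by blast
  have y: "[a * (x mod q) = 1] (mod q)"
    using x by (simp add: cong_def mod_mult_right_eq)
  have "x mod q \<noteq> 0"
    using y assms(1) by (auto simp: cong_def)
  moreover have "0 \<le> x mod q" "x mod q < q"
    using assms(1) by simp_all
  ultimately have ex: "1 \<le> x mod q \<and> x mod q \<le> q - 1 \<and> [a * (x mod q) = 1] (mod q)"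
    using y by linarith
  show ?thesis
  proof (rule ex1I)
    show "1 \<le> x mod q \<and> x mod q \<le> q - 1 \<and> [a * (x mod q) = 1] (mod q)"
      by (rule ex)
  next
    fix b assume b: "1 \<le> b \<and> b \<le> q - 1 \<and> [a * b = 1] (mod q)"
    then have "[a * b = a * (x mod q)] (mod q)"
      using y cong_sym cong_trans by blast
    then have "[b = x mod q] (mod q)"
      using assms(2) by (simp add: cong_mult_lcancel)
    then show "b = x mod q"
      using b by (simp add: cong_def)
  qed
qed

lemma inv_residue_props:
  fixes q a :: int
  assumes "q > 1" and "coprime a q"
  shows "1 \<le> inv_residue q a" and "inv_residue q a \<le> q - 1"
    and "[a * inv_residue q a = 1] (mod q)"
  using theI'[OF inv_residue_unique_existence[OF assms]]
  unfolding inv_residue_def by blast+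

end

(* Karatsuba's method, with a running through products of two primes r, s in (k, X], where X is
   about q^(1/(2k-1)).  If all these a had an odd inverse, then a suitable trigonometric polynomial
   would be at least 1 at every inverse, so that a Kloosterman sum over the products r s would be of
   trivial size.  Raising that sum to the k-th power in each variable turns it into a bilinear
   form in sums of k inverses of primes, which the large sieve estimates in terms of the number of
   solutions of 1/r_1 + ... + 1/r_k = 1/s_1 + ... + 1/s_k modulo q.  As X is small, such a
   congruence is an equality of rational numbers, so there are only the diagonal solutions, and
   Chebyshev's lower bound for the number of primes up to X gives a contradiction when
   q is large.  For small q one takes a = q + 1. *)
theory Submission
  imports "HOL-Analysis.Convex" "HOL-Real_Asymp.Real_Asymp" Defs
begin

section \<open>Additive characters modulo \<open>q\<close>\<close>

definition add_char :: "nat \<Rightarrow> int \<Rightarrow> complex" where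
  "add_char q x = cis (2 * pi * of_int x / of_nat q)"

lemma norm_add_char [simp]: "norm (add_char q x) = 1"
  by (simp add: add_char_def)

lemma add_char_0 [simp]: "add_char q 0 = 1"
  by (simp add: add_char_def)

lemma add_char_add: "add_char q (x + y) = add_char q x * add_char q y"
  by (simp add: add_char_def cis_mult add_divide_distrib distrib_left)

lemma add_char_diff: "add_char q (x - y) = add_char q x * cnj (add_char q y)"
  by (simp add: add_char_def cis_mult cis_cnj diff_divide_distrib right_diff_distrib)

lemma add_char_mult_nat: "add_char q (int n * x) = add_char q x ^ n"
  by (induction n) (simp_all add: add_char_add algebra_simps)

lemma add_char_eq_1_iff:
  assumes "q > 0"
  shows "add_char q x = 1 \<longleftrightarrow> int q dvd x"
proof
  assume "add_char q x = 1"
  then have "cos (2 * pi * of_int x / of_nat q) = 1"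
    by (simp add: add_char_def complex_eq_iff)
  then obtain n :: int where "2 * pi * of_int x / of_nat q = of_int n * 2 * pi"
    by (auto simp: cos_one_2pi_int)
  then have "real_of_int x = real_of_int (n * int q)"
    using assms by (simp add: field_simps)
  then show "int q dvd x"
    by (simp only: of_int_eq_iff) simp
next
  assume "int q dvd x"
  then obtain n where "x = int q * n" by blast
  then have "2 * pi * of_int x / of_nat q = 2 * pi * of_int n"
    using assms by simp
  then show "add_char q x = 1"
    by (simp only: add_char_def) (simp add: complex_eq_iff)
qed

lemma add_char_cong:
  assumes "q > 0" "[x = y] (mod int q)"
  shows "add_char q x = add_char q y"
proof -
  have "add_char q (x - y) = 1"
    using assms by (simp add: add_char_eq_1_iff cong_iff_dvd_diff)
  then show ?thesis
    using add_char_add[of q "x - y" y] by simp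
qed

text \<open>Orthogonality: the sum is geometric, and its ratio \<open>add_char q d\<close> is a
  \<open>q\<close>-th root of unity that equals 1 only when \<open>q\<close> divides
  \<open>d\<close>.\<close>

lemma sum_add_char:
  assumes "q > 0"
  shows "(\<Sum>x<q. add_char q (int x * d)) = (if int q dvd d then of_nat q else 0)"
proof (cases "int q dvd d")
  case True
  then have "add_char q d = 1"
    by (simp add: add_char_eq_1_iff assms)
  with True show ?thesis
    by (simp add: add_char_mult_nat)
next
  case False
  moreover have "add_char q d ^ q = 1"
    by (simp add: add_char_eq_1_iff assms flip: add_char_mult_nat)
  ultimately show ?thesis
    by (simp add: add_char_mult_nat geometric_sum add_char_eq_1_iff assms)
qed

section \<open>Additive energy and the double large sieve\<close>

text \<open>Indices rather than values are counted, so \<open>\<phi>\<close> may repeat values. For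
  \<open>\<phi>\<close> a sum of \<open>k\<close> inverses over lists of length \<open>k\<close>,
  this is the number of solutions of the congruence between two such sums.\<close>

definition energy :: "nat \<Rightarrow> 'a set \<Rightarrow> ('a \<Rightarrow> int) \<Rightarrow> nat" where
  "energy q U \<phi> = card {(u, u') \<in> U \<times> U. [\<phi> u = \<phi> u'] (mod int q)}"

lemma energy_eq_sum:
  assumes "finite U"
  shows "energy q U \<phi> = (\<Sum>u\<in>U. \<Sum>u'\<in>U. if [\<phi> u = \<phi> u'] (mod int q) then 1 else 0)"
proof -
  have "energy q U \<phi> = card {z \<in> U \<times> U. [\<phi> (fst z) = \<phi> (snd z)] (mod int q)}"
    unfolding energy_def by (rule arg_cong[of _ _ card]) auto
  also have "\<dots> = (\<Sum>z\<in>U \<times> U. if [\<phi> (fst z) = \<phi> (snd z)] (mod int q) then 1 else 0)"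
    using assms by (simp add: sum.If_cases Int_def conj_commute)
  also have "\<dots> = (\<Sum>u\<in>U. \<Sum>u'\<in>U. if [\<phi> u = \<phi> u'] (mod int q) then 1 else 0)"
    by (simp add: sum.cartesian_product case_prod_beta)
  finally show ?thesis .
qed

lemma cong_int_iff_nat_mod:
  assumes "x < q"
  shows "[a = int x] (mod int q) \<longleftrightarrow> nat (a mod int q) = x"
proof -
  have "a mod int q \<ge> 0"
    using assms by simp
  moreover have "int x mod int q = int x"
    using assms by simp
  ultimately show ?thesis
    by (auto simp: cong_def nat_eq_iff)
qed

text \<open>Each pair counted by the energy has exactly one common residue \<open>x\<close>. The
  energy thus becomes a sum of squared representation numbers, the form in which Cauchy-Schwarz
  produces it.\<close>

lemma energy_eq_sum_fibres:
  assumes "finite U" "q > 0"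
  shows "energy q U \<phi> = (\<Sum>x<q. card {u \<in> U. [\<phi> u = int x] (mod int q)} ^ 2)"
proof -
  have fib: "card {u \<in> U. [\<phi> u = int x] (mod int q)} =
      (\<Sum>u\<in>U. if [\<phi> u = int x] (mod int q) then 1 else 0)" for x
    using assms by (simp add: sum.If_cases Int_def conj_commute)
  have ind: "(\<Sum>x<q. (if [\<phi> u = int x] (mod int q) then 1 else 0) *
      (if [\<phi> u' = int x] (mod int q) then 1 else 0)) =
      (if [\<phi> u = \<phi> u'] (mod int q) then 1 else (0::nat))" for u u'
  proof -
    have *: "[\<phi> u = int x] (mod int q) \<longleftrightarrow> x = nat (\<phi> u mod int q)" if "x < q" for x
      using that by (auto simp: cong_int_iff_nat_mod)
    have "(\<Sum>x<q. (if [\<phi> u = int x] (mod int q) then 1 else 0) *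
        (if [\<phi> u' = int x] (mod int q) then 1 else (0::nat))) =
        (\<Sum>x<q. if x = nat (\<phi> u mod int q) then
          (if [\<phi> u' = \<phi> u mod int q] (mod int q) then 1 else 0) else 0)"
      using assms by (intro sum.cong refl) (simp add: *)
    also have "nat (\<phi> u mod int q) < q"
      using assms by (simp add: nat_less_iff)
    then have "(\<Sum>x<q. if x = nat (\<phi> u mod int q) then
          (if [\<phi> u' = \<phi> u mod int q] (mod int q) then 1 else (0::nat)) else 0) =
          (if [\<phi> u' = \<phi> u mod int q] (mod int q) then 1 else 0)"
      by (subst sum.delta) auto
    also have "\<dots> = (if [\<phi> u = \<phi> u'] (mod int q) then 1 else 0)"
      by (auto simp: cong_def)
    finally show ?thesis .
  qed
  have "(\<Sum>x<q. card {u \<in> U. [\<phi> u = int x] (mod int q)} ^ 2) =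
     (\<Sum>x<q. \<Sum>u\<in>U. \<Sum>u'\<in>U. (if [\<phi> u = int x] (mod int q) then 1 else 0) *
      (if [\<phi> u' = int x] (mod int q) then 1 else 0))"
    unfolding fib power2_eq_square sum_product ..
  also have "\<dots> = (\<Sum>u\<in>U. \<Sum>u'\<in>U. \<Sum>x<q. (if [\<phi> u = int x] (mod int q) then 1 else 0) *
      (if [\<phi> u' = int x] (mod int q) then 1 else 0))"
    by (subst sum.swap, rule sum.cong[OF refl], rule sum.swap)
  also have "\<dots> = energy q U \<phi>"
    unfolding ind energy_eq_sum[OF assms(1)] ..
  finally show ?thesis ..
qed

text \<open>Expanding the square and summing over \<open>x\<close> leaves, by orthogonality, only
  pairs with congruent \<open>\<psi>\<close> values; coefficients of modulus at most 1 do not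
  enlarge their contribution.\<close>

lemma mean_square_add_char:
  assumes "finite V" "q > 0" "\<And>v. norm (\<beta> v) \<le> 1"
  shows "(\<Sum>x<q. (norm (\<Sum>v\<in>V. \<beta> v * add_char q (int x * \<psi> v)))\<^sup>2) \<le> real q * real (energy q V \<psi>)"
proof -
  let ?B = "\<lambda>x. \<Sum>v\<in>V. \<beta> v * add_char q (int x * \<psi> v)"
  have "complex_of_real (\<Sum>x<q. (norm (?B x))\<^sup>2) = (\<Sum>x<q. ?B x * cnj (?B x))"
    unfolding of_real_sum of_real_power by (intro sum.cong refl) (simp only: complex_norm_square flip: of_real_power)
  also have "\<dots> = (\<Sum>x<q. \<Sum>v\<in>V. \<Sum>v'\<in>V. \<beta> v * cnj (\<beta> v') * add_char q (int x * (\<psi> v - \<psi> v')))"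
    by (simp add: cnj_sum sum_product add_char_diff right_diff_distrib mult_ac)
  also have "\<dots> = (\<Sum>v\<in>V. \<Sum>v'\<in>V. \<Sum>x<q. \<beta> v * cnj (\<beta> v') * add_char q (int x * (\<psi> v - \<psi> v')))"
    by (subst sum.swap, rule sum.cong[OF refl], rule sum.swap)
  also have "\<dots> = (\<Sum>v\<in>V. \<Sum>v'\<in>V. \<beta> v * cnj (\<beta> v') *
      (if [\<psi> v = \<psi> v'] (mod int q) then of_nat q else 0))"
    by (simp add: sum_add_char assms cong_iff_dvd_diff flip: sum_distrib_left)
  finally have eq: "complex_of_real (\<Sum>x<q. (norm (?B x))\<^sup>2) = \<dots>" .
  have "(\<Sum>x<q. (norm (?B x))\<^sup>2) = norm (complex_of_real (\<Sum>x<q. (norm (?B x))\<^sup>2))"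
    by (subst norm_of_real) (simp add: sum_nonneg)
  also have "\<dots> \<le> (\<Sum>v\<in>V. \<Sum>v'\<in>V. real q * (if [\<psi> v = \<psi> v'] (mod int q) then 1 else 0))"
    unfolding eq
  proof (intro order_trans[OF norm_sum] sum_mono)
    fix v v'
    have "norm (\<beta> v) * norm (\<beta> v') \<le> 1"
      using mult_mono[of "norm (\<beta> v)" 1 "norm (\<beta> v')" 1] assms(3) by simp
    then show "norm (\<beta> v * cnj (\<beta> v') * (if [\<psi> v = \<psi> v'] (mod int q) then of_nat q else 0)) \<le>
        real q * (if [\<psi> v = \<psi> v'] (mod int q) then 1 else 0)"
      using mult_right_mono[of "norm (\<beta> v) * norm (\<beta> v')" 1 "real q"] by (simp add: norm_mult)
  qed
  also have "\<dots> = real q * real (energy q V \<psi>)"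
    by (simp add: energy_eq_sum assms sum_distrib_left of_nat_sum if_distrib[of real] cong: if_cong)
  finally show ?thesis .
qed

text \<open>Grouping the \<open>u\<close> by the residue of \<open>\<phi> u\<close> gives a single
  sum over \<open>x\<close> modulo \<open>q\<close>, to which Cauchy-Schwarz applies. The
  \<open>A x\<close> are controlled by the fibre sizes, the \<open>B x\<close> by the mean
  square.\<close>

lemma double_large_sieve:
  assumes "finite U" "finite V" "q > 0" "\<And>u. norm (\<alpha> u) \<le> 1" "\<And>v. norm (\<beta> v) \<le> 1"
  shows "(norm (\<Sum>u\<in>U. \<Sum>v\<in>V. \<alpha> u * \<beta> v * add_char q (\<phi> u * \<psi> v)))\<^sup>2
           \<le> real q * real (energy q U \<phi>) * real (energy q V \<psi>)"
proof -
  define F where "F x = {u \<in> U. [\<phi> u = int x] (mod int q)}" for x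
  define A where "A x = (\<Sum>u\<in>F x. \<alpha> u)" for x
  define B where "B x = (\<Sum>v\<in>V. \<beta> v * add_char q (int x * \<psi> v))" for x
  have "(\<Sum>u\<in>U. \<Sum>v\<in>V. \<alpha> u * \<beta> v * add_char q (\<phi> u * \<psi> v)) =
      (\<Sum>x<q. \<Sum>u\<in>{u \<in> U. nat (\<phi> u mod int q) = x}. \<Sum>v\<in>V. \<alpha> u * \<beta> v * add_char q (\<phi> u * \<psi> v))"
    using assms by (intro sum.group[symmetric]) (auto simp: nat_less_iff)
  also have "\<dots> = (\<Sum>x<q. A x * B x)"
  proof (intro sum.cong refl)
    fix x assume x: "x \<in> {..<q}"
    have "{u \<in> U. nat (\<phi> u mod int q) = x} = F x"
      using x by (simp add: F_def cong_int_iff_nat_mod)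
    moreover have "add_char q (\<phi> u * \<psi> v) = add_char q (int x * \<psi> v)" if "u \<in> F x" for u v
      using that assms by (intro add_char_cong cong_mult) (auto simp: F_def)
    ultimately show "(\<Sum>u\<in>{u \<in> U. nat (\<phi> u mod int q) = x}. \<Sum>v\<in>V. \<alpha> u * \<beta> v * add_char q (\<phi> u * \<psi> v)) =
        A x * B x"
      by (simp add: A_def B_def sum_product mult_ac)
  qed
  finally have eq: "(\<Sum>u\<in>U. \<Sum>v\<in>V. \<alpha> u * \<beta> v * add_char q (\<phi> u * \<psi> v)) = (\<Sum>x<q. A x * B x)" .
  have "norm (\<Sum>x<q. A x * B x) \<le> (\<Sum>x<q. norm (A x) * norm (B x))"
    by (rule order_trans[OF norm_sum]) (simp add: norm_mult)
  then have "(norm (\<Sum>x<q. A x * B x))\<^sup>2 \<le> (\<Sum>x<q. norm (A x) * norm (B x))\<^sup>2"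
    by (intro power_mono) auto
  also have "\<dots> \<le> (\<Sum>x<q. (norm (A x))\<^sup>2) * (\<Sum>x<q. (norm (B x))\<^sup>2)"
    by (rule Cauchy_Schwarz_ineq_sum)
  also have "\<dots> \<le> real (energy q U \<phi>) * (real q * real (energy q V \<psi>))"
  proof (rule mult_mono)
    have "norm (A x) \<le> real (card (F x))" for x
      unfolding A_def using sum_norm_le[of "F x" \<alpha> "\<lambda>_. 1"] assms(4) by simp
    then have "(\<Sum>x<q. (norm (A x))\<^sup>2) \<le> (\<Sum>x<q. (real (card (F x)))\<^sup>2)"
      by (intro sum_mono power_mono) auto
    also have "\<dots> = real (energy q U \<phi>)"
      by (simp add: energy_eq_sum_fibres assms F_def)
    finally show "(\<Sum>x<q. (norm (A x))\<^sup>2) \<le> real (energy q U \<phi>)" .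
    show "(\<Sum>x<q. (norm (B x))\<^sup>2) \<le> real q * real (energy q V \<psi>)"
      unfolding B_def using assms by (intro mean_square_add_char)
  qed (auto simp: sum_nonneg)
  finally show ?thesis
    unfolding eq by (simp add: mult_ac)
qed

section \<open>Powers of bilinear sums\<close>

text \<open>Jensen's inequality for the convex function \<open>x ^ k\<close> with equal weights,
  cleared of denominators.\<close>

lemma power_mean_sum:
  fixes f :: "'a \<Rightarrow> real"
  assumes "finite U" "k > 0" "\<And>u. u \<in> U \<Longrightarrow> f u \<ge> 0"
  shows "(\<Sum>u\<in>U. f u) ^ k \<le> real (card U) ^ (k - 1) * (\<Sum>u\<in>U. f u ^ k)"
proof (cases "U = {}")
  case False
  let ?n = "real (card U)"
  have n: "?n > 0"
    using False assms(1) by (simp add: card_gt_0_iff)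
  have "convex_on {0::real..} (\<lambda>x. x ^ k)"
    using convex_power_odd[of k] convex_on_subset[OF convex_power_even[of k], of "{0..}"]
    by (cases "even k") auto
  then have "(\<Sum>u\<in>U. (1 / ?n) *\<^sub>R f u) ^ k \<le> (\<Sum>u\<in>U. (1 / ?n) * f u ^ k)"
    using assms False n by (intro convex_on_sum) auto
  then have "(\<Sum>u\<in>U. f u) ^ k / ?n ^ k \<le> (\<Sum>u\<in>U. f u ^ k) / ?n"
    by (simp add: power_divide flip: sum_divide_distrib)
  moreover have "?n ^ k = ?n ^ (k - 1) * ?n"
    using assms(2) by (cases k) auto
  ultimately show ?thesis
    using n by (simp add: field_simps)
qed (use assms in \<open>simp add: power_0_left\<close>)

text \<open>Ordered \<open>k\<close>-tuples, repetitions allowed, as the index set of an expanded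
  \<open>k\<close>-th power; keeping the order avoids multinomial coefficients.\<close>

definition lists_of :: "'a set \<Rightarrow> nat \<Rightarrow> 'a list set" where
  "lists_of S k = {xs. set xs \<subseteq> S \<and> length xs = k}"

lemma finite_lists_of [simp]: "finite S \<Longrightarrow> finite (lists_of S k)"
  unfolding lists_of_def by (rule finite_lists_length_eq)

lemma card_lists_of: "finite S \<Longrightarrow> card (lists_of S k) = card S ^ k"
  unfolding lists_of_def by (rule card_lists_length_eq)

lemma lists_of_0: "lists_of S 0 = {[]}"
  by (auto simp: lists_of_def)

lemma lists_of_Suc: "lists_of S (Suc k) = (\<lambda>(x, xs). x # xs) ` (S \<times> lists_of S k)"
  by (auto simp: lists_of_def length_Suc_conv image_iff)

lemma sum_power_eq_sum_lists_of:
  fixes f :: "'a \<Rightarrow> 'b::comm_semiring_1"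
  shows "(\<Sum>s\<in>S. f s) ^ k = (\<Sum>xs\<in>lists_of S k. prod_list (map f xs))"
proof (induction k)
  case (Suc k)
  have "(\<Sum>xs\<in>lists_of S (Suc k). prod_list (map f xs)) =
      (\<Sum>(x, xs)\<in>S \<times> lists_of S k. f x * prod_list (map f xs))"
    unfolding lists_of_Suc by (subst sum.reindex) (auto simp: inj_on_def case_prod_beta)
  then show ?case
    by (simp add: Suc sum_product sum.cartesian_product)
qed (simp add: lists_of_0)

lemma prod_list_add_char:
  "prod_list (map (\<lambda>s. \<beta> s * add_char q (x * \<psi> s)) xs) =
     prod_list (map \<beta> xs) * add_char q (x * sum_list (map \<psi> xs))"
  by (induction xs) (simp_all add: add_char_add distrib_left mult_ac)

lemma norm_prod_list_le_1:
  fixes \<beta> :: "'a \<Rightarrow> 'b::{real_normed_div_algebra, comm_ring_1}"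
  assumes "\<And>s. norm (\<beta> s) \<le> 1"
  shows "norm (prod_list (map \<beta> xs)) \<le> 1"
proof (induction xs)
  case (Cons x xs)
  then show ?case
    using mult_mono[of "norm (\<beta> x)" 1 "norm (prod_list (map \<beta> xs))" 1] assms
    by (simp add: norm_mult)
qed simp

text \<open>Hoelder's inequality in \<open>u\<close>, after which the \<open>k\<close>-th power of
  the inner sum expands over lists. The phases that replace absolute values go into new
  coefficients, again bounded by 1, so the result is a bilinear form of the same shape and the
  argument can be repeated in the other variable.\<close>

lemma bilinear_sum_power_le:
  assumes "finite U" "k > 0" "\<And>u. norm (\<alpha> u) \<le> 1" "\<And>s. norm (\<beta> s) \<le> 1"
  obtains \<alpha>' \<beta>' :: "_ \<Rightarrow> complex"
  where "\<And>u. norm (\<alpha>' u) \<le> 1" "\<And>xs. norm (\<beta>' xs) \<le> 1"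
    "norm (\<Sum>u\<in>U. \<Sum>s\<in>S. \<alpha> u * \<beta> s * add_char q (\<phi> u * \<psi> s)) ^ k
      \<le> real (card U) ^ (k - 1) *
         norm (\<Sum>u\<in>U. \<Sum>xs\<in>lists_of S k. \<alpha>' u * \<beta>' xs * add_char q (\<phi> u * sum_list (map \<psi> xs)))"
proof
  define G where "G u = (\<Sum>s\<in>S. \<beta> s * add_char q (\<phi> u * \<psi> s))" for u
  \<comment> \<open>Rotates \<open>G u ^ k\<close> onto its absolute value; where the power
    vanishes, \<open>sgn 0 = 0\<close> still gives modulus at most 1.\<close>
  define \<alpha>' where "\<alpha>' u = cnj (sgn (G u ^ k))" for u
  define \<beta>' where "\<beta>' xs = prod_list (map \<beta> xs)" for xs
  show "norm (\<alpha>' u) \<le> 1" for u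
    by (simp add: \<alpha>'_def norm_sgn)
  show "norm (\<beta>' xs) \<le> 1" for xs
    unfolding \<beta>'_def by (rule norm_prod_list_le_1) fact
  have sgn_mult: "cnj (sgn z) * z = of_real (norm z)" for z :: complex
    by (cases "z = 0")
       (simp_all add: sgn_eq complex_norm_square[symmetric] power2_eq_square mult.commute)
  have "norm (\<Sum>u\<in>U. \<Sum>s\<in>S. \<alpha> u * \<beta> s * add_char q (\<phi> u * \<psi> s)) = norm (\<Sum>u\<in>U. \<alpha> u * G u)"
    by (simp add: G_def sum_distrib_left mult_ac)
  also have "\<dots> \<le> (\<Sum>u\<in>U. norm (G u))"
  proof (rule sum_norm_le)
    show "norm (\<alpha> u * G u) \<le> norm (G u)" for u
      using mult_right_mono[OF assms(3), of "norm (G u)" u] by (simp add: norm_mult)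
  qed
  finally have "norm (\<Sum>u\<in>U. \<Sum>s\<in>S. \<alpha> u * \<beta> s * add_char q (\<phi> u * \<psi> s)) ^ k \<le> (\<Sum>u\<in>U. norm (G u)) ^ k"
    by (intro power_mono) auto
  also have "\<dots> \<le> real (card U) ^ (k - 1) * (\<Sum>u\<in>U. norm (G u) ^ k)"
    using assms by (intro power_mean_sum) auto
  also have "(\<Sum>u\<in>U. norm (G u) ^ k) = norm (complex_of_real (\<Sum>u\<in>U. norm (G u) ^ k))"
    by (subst norm_of_real) (simp add: sum_nonneg)
  also have "complex_of_real (\<Sum>u\<in>U. norm (G u) ^ k) = (\<Sum>u\<in>U. \<alpha>' u * G u ^ k)"
    by (simp add: \<alpha>'_def sgn_mult norm_power)
  also have "\<dots> = (\<Sum>u\<in>U. \<Sum>xs\<in>lists_of S k. \<alpha>' u * \<beta>' xs * add_char q (\<phi> u * sum_list (map \<psi> xs)))"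
    by (simp add: G_def \<beta>'_def sum_power_eq_sum_lists_of prod_list_add_char sum_distrib_left mult_ac)
  finally show "norm (\<Sum>u\<in>U. \<Sum>s\<in>S. \<alpha> u * \<beta> s * add_char q (\<phi> u * \<psi> s)) ^ k
      \<le> real (card U) ^ (k - 1) *
         norm (\<Sum>u\<in>U. \<Sum>xs\<in>lists_of S k. \<alpha>' u * \<beta>' xs * add_char q (\<phi> u * sum_list (map \<psi> xs)))" .
qed

lemma energy_mult_coprime:
  assumes "coprime h (int q)"
  shows "energy q U (\<lambda>u. h * \<phi> u) = energy q U \<phi>"
  using assms by (simp add: energy_def cong_mult_lcancel)

text \<open>The power step is applied once in each variable, then the double large sieve. Two
  \<open>k\<close>-th powers and the final square give the exponent \<open>2 * k\<^sup>2\<close>;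
  each power step contributes \<open>2 * k * (k - 1)\<close> factors \<open>card S\<close>. The unit
  \<open>h\<close> does not change the energy.\<close>

lemma bilinear_sum_le_energy:
  fixes \<psi> :: "'a \<Rightarrow> int"
  defines "\<Psi> \<equiv> \<lambda>xs. sum_list (map \<psi> xs)"
  assumes "finite S" "k > 0" "q > 0" "coprime h (int q)"
  shows "norm (\<Sum>r\<in>S. \<Sum>s\<in>S. add_char q (h * \<psi> r * \<psi> s)) ^ (2 * k\<^sup>2)
    \<le> real (card S) ^ (4 * k * (k - 1)) * real q * real (energy q (lists_of S k) \<Psi>) ^ 2"
proof -
  let ?L = "lists_of S k" and ?n = "real (card S)"
  let ?T = "norm (\<Sum>r\<in>S. \<Sum>s\<in>S. add_char q (h * \<psi> r * \<psi> s))"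
  obtain \<alpha> \<beta> where ab: "\<And>u. norm (\<alpha> u) \<le> 1" "\<And>xs. norm (\<beta> xs) \<le> 1"
    "?T ^ k \<le> ?n ^ (k - 1) *
         norm (\<Sum>u\<in>S. \<Sum>xs\<in>?L. \<alpha> u * \<beta> xs * add_char q (h * \<psi> u * \<Psi> xs))"
    using bilinear_sum_power_le[where U = S and k = k and \<alpha> = "\<lambda>_. 1" and \<beta> = "\<lambda>_. 1" and S = S and q = q
      and \<phi> = "\<lambda>u. h * \<psi> u" and \<psi> = \<psi>, OF \<open>finite S\<close> \<open>k > 0\<close>]
    unfolding \<Psi>_def by (simp only: norm_one order_refl mult_1) blast
  obtain \<alpha>' \<beta>' where ab': "\<And>u. norm (\<alpha>' u) \<le> 1" "\<And>xs. norm (\<beta>' xs) \<le> 1"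
    "norm (\<Sum>xs\<in>?L. \<Sum>u\<in>S. \<beta> xs * \<alpha> u * add_char q (h * \<Psi> xs * \<psi> u)) ^ k \<le> real (card ?L) ^ (k - 1) *
         norm (\<Sum>xs\<in>?L. \<Sum>ys\<in>?L. \<alpha>' xs * \<beta>' ys * add_char q (h * \<Psi> xs * \<Psi> ys))"
    using bilinear_sum_power_le[where U = ?L and k = k and \<alpha> = \<beta> and \<beta> = \<alpha> and S = S and q = q
      and \<phi> = "\<lambda>xs. h * \<Psi> xs" and \<psi> = \<psi>, OF finite_lists_of[OF \<open>finite S\<close>] \<open>k > 0\<close> ab(2) ab(1)]
    unfolding \<Psi>_def by blast
  define V1 where "V1 = norm (\<Sum>u\<in>S. \<Sum>xs\<in>?L. \<alpha> u * \<beta> xs * add_char q (h * \<psi> u * \<Psi> xs))"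
  define V2 where "V2 = norm (\<Sum>xs\<in>?L. \<Sum>ys\<in>?L. \<alpha>' xs * \<beta>' ys * add_char q (h * \<Psi> xs * \<Psi> ys))"
  have T: "?T ^ k \<le> ?n ^ (k - 1) * V1"
    using ab(3) by (simp add: V1_def)
  \<comment> \<open>Interchanging the sums makes the lists the outer variable, as in the second
    application of the power step.\<close>
  have "V1 = norm (\<Sum>xs\<in>?L. \<Sum>u\<in>S. \<beta> xs * \<alpha> u * add_char q (h * \<Psi> xs * \<psi> u))"
    unfolding V1_def by (subst sum.swap) (simp add: mult_ac)
  then have V1: "V1 ^ k \<le> (?n ^ k) ^ (k - 1) * V2"
    using ab'(3) assms(2) by (simp add: V2_def card_lists_of)
  have V2: "V2\<^sup>2 \<le> real q * real (energy q ?L \<Psi>) ^ 2"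
    unfolding V2_def
    using double_large_sieve[of ?L ?L q \<alpha>' \<beta>' "\<lambda>xs. h * \<Psi> xs" \<Psi>] assms(2-) ab'(1,2)
    by (simp add: energy_mult_coprime power2_eq_square mult_ac)
  have "?T ^ (2 * k\<^sup>2) = ((?T ^ k) ^ k)\<^sup>2"
    by (simp add: power2_eq_square[of k] mult_ac flip: power_mult)
  also have "\<dots> \<le> ((?n ^ (k - 1) * V1) ^ k)\<^sup>2"
    using T by (intro power_mono) auto
  also have "\<dots> = (?n ^ (k * (k - 1)) * V1 ^ k)\<^sup>2"
    by (simp add: power_mult_distrib mult_ac flip: power_mult)
  also have "\<dots> \<le> (?n ^ (k * (k - 1)) * ((?n ^ k) ^ (k - 1) * V2))\<^sup>2"
    using V1 by (intro power_mono mult_left_mono) (auto simp: V1_def)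
  also have "\<dots> = ?n ^ (4 * k * (k - 1)) * V2\<^sup>2"
    by (simp add: power_mult_distrib mult_ac flip: power_mult power_add)
  also have "\<dots> \<le> ?n ^ (4 * k * (k - 1)) * (real q * real (energy q ?L \<Psi>) ^ 2)"
    using V2 by (intro mult_left_mono) auto
  finally show ?thesis by (simp add: mult_ac)
qed

section \<open>Sums of reciprocals of primes, as fractions and modulo \<open>q\<close>\<close>

text \<open>Numerator of the sum of the \<open>1 / x\<close> over the unreduced common denominator
  \<open>prod_list\<close>. As a natural number it can be both bounded and reduced modulo
  \<open>q\<close>.\<close>

fun recip_num :: "nat list \<Rightarrow> nat" where
  "recip_num [] = 0"
| "recip_num (x # xs) = prod_list xs + x * recip_num xs"

lemma sum_list_recip:
  assumes "0 \<notin> set xs"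
  shows "(\<Sum>x\<leftarrow>xs. 1 / real x) = real (recip_num xs) / real (prod_list xs)"
  using assms
proof (induction xs)
  case (Cons x xs)
  then have "prod_list xs \<noteq> 0" "x \<noteq> 0"
    by (auto simp: prod_list_zero_iff)
  with Cons show ?case
    by (simp add: field_simps)
qed simp

lemma prod_list_le_power:
  fixes X :: nat
  assumes "\<And>x. x \<in> set xs \<Longrightarrow> x \<le> X"
  shows "prod_list xs \<le> X ^ length xs"
  using assms by (induction xs) (auto intro!: mult_le_mono)

lemma recip_num_le:
  assumes "\<And>x. x \<in> set xs \<Longrightarrow> x \<le> X"
  shows "recip_num xs \<le> length xs * X ^ (length xs - 1)"
  using assms
proof (induction xs)
  case (Cons x xs)
  have "recip_num (x # xs) \<le> X ^ length xs + X * (length xs * X ^ (length xs - 1))"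
    using Cons prod_list_le_power[of xs X] by (auto intro!: add_mono mult_le_mono)
  also have "X * (length xs * X ^ (length xs - 1)) = length xs * X ^ length xs"
    by (cases "length xs") (auto simp: algebra_simps)
  finally show ?case by simp
qed simp

text \<open>The same fraction read modulo \<open>m\<close>, with \<open>\<psi> s\<close> in the role
  of \<open>1 / s\<close>.\<close>

lemma recip_num_cong:
  assumes "\<And>s. s \<in> set xs \<Longrightarrow> [int s * \<psi> s = 1] (mod m)"
  shows "[int (recip_num xs) = int (prod_list xs) * sum_list (map \<psi> xs)] (mod m)"
  using assms
proof (induction xs)
  case (Cons x xs)
  have "[int (prod_list xs) * 1 + int x * int (recip_num xs) =
      int (prod_list xs) * (int x * \<psi> x) + int x * (int (prod_list xs) * sum_list (map \<psi> xs))] (mod m)"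
    using Cons by (intro cong_add cong_mult cong_refl) (auto intro: cong_sym)
  then show ?case
    by (simp add: algebra_simps)
qed simp

text \<open>Isolates the \<open>p\<close>-part: the copies of \<open>p\<close> give the first
  fraction, and the other terms have denominators prime to \<open>p\<close>, hence so has their
  sum.\<close>

lemma sum_list_recip_primes_split:
  fixes p :: nat
  assumes "prime p" "\<And>x. x \<in> set xs \<Longrightarrow> prime x"
  shows "\<exists>a b. \<not> p dvd b \<and> (\<Sum>x\<leftarrow>xs. 1 / real x) = real (count_list xs p) / real p + real a / real b"
  using assms(2)
proof (induction xs)
  case Nil
  have "\<not> p dvd 1"
    using assms(1) not_prime_unit by blast
  then show ?case
    by (intro exI[of _ 0] exI[of _ 1]) simp
next
  case (Cons x xs)
  then obtain a b where ab: "\<not> p dvd b"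
    "(\<Sum>x\<leftarrow>xs. 1 / real x) = real (count_list xs p) / real p + real a / real b"
    by auto
  show ?case
  proof (cases "x = p")
    case True
    with ab show ?thesis
      by (intro exI[of _ a] exI[of _ b]) (simp add: add_divide_distrib)
  next
    case False
    have "x > 0" "b > 0"
      using Cons.prems[of x] ab(1) by (auto intro: prime_gt_0_nat gr0I)
    moreover have "\<not> p dvd x"
      using False Cons.prems[of x] assms(1) primes_dvd_imp_eq by auto
    moreover have "1 / real x + real a / real b = real (b + a * x) / real (b * x)"
      using \<open>x > 0\<close> \<open>b > 0\<close> by (simp add: field_simps)
    ultimately show ?thesis
      using False ab assms(1)
      by (intro exI[of _ "b + a * x"] exI[of _ "b * x"])
         (simp add: prime_dvd_mult_iff)
  qed
qed

text \<open>If a prime \<open>p\<close> occurred only in \<open>ys\<close>, the right-hand sum would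
  have \<open>p\<close> in its reduced denominator, because the multiplicity of \<open>p\<close> in
  \<open>ys\<close> is positive and below \<open>p\<close>; the left-hand sum would not.\<close>

lemma sum_list_recip_primes_eq_imp_subset:
  assumes "\<And>x. x \<in> set xs \<union> set ys \<Longrightarrow> prime x \<and> length ys < x"
    and eq: "(\<Sum>x\<leftarrow>xs. 1 / real x) = (\<Sum>y\<leftarrow>ys. 1 / real y)"
  shows "set ys \<subseteq> set xs"
proof
  fix p assume p: "p \<in> set ys"
  show "p \<in> set xs"
  proof (rule ccontr)
    assume "p \<notin> set xs"
    have prime: "prime p" "length ys < p"
      using assms(1)[of p] p by auto
    obtain a b where ab: "\<not> p dvd b" "(\<Sum>x\<leftarrow>xs. 1 / real x) = real a / real b"
      using sum_list_recip_primes_split[of p xs] assms(1) prime \<open>p \<notin> set xs\<close>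
      by (auto simp: count_list_0_iff)
    obtain c d where cd: "\<not> p dvd d"
      "(\<Sum>y\<leftarrow>ys. 1 / real y) = real (count_list ys p) / real p + real c / real d"
      using sum_list_recip_primes_split[of p ys] assms(1) prime by auto
    define m where "m = count_list ys p"
    have "b > 0" "d > 0" "p > 0"
      using ab cd prime by (auto intro!: gr0I)
    moreover have "real a / real b = real m / real p + real c / real d"
      using ab cd eq by (simp add: m_def)
    \<comment> \<open>With denominators cleared, every term except \<open>m * b * d\<close> is
      visibly a multiple of \<open>p\<close>.\<close>
    ultimately have "real (a * p * d) = real (m * b * d + c * b * p)"
      by (simp add: field_simps)
    then have "a * p * d = m * b * d + c * b * p"
      by (simp only: of_nat_eq_iff)
    then have "p dvd m * b * d + c * b * p"
      by (metis dvd_mult dvd_mult2 dvd_refl)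
    then have "p dvd m * b * d"
      by (simp add: dvd_add_left_iff)
    then have "p dvd m"
      using ab cd prime by (simp add: prime_dvd_mult_iff)
    moreover have "0 < m" "m < p"
      using p prime count_le_length[of ys p] count_list_0_iff[of ys p] by (auto simp: m_def)
    ultimately show False
      using nat_dvd_not_less by blast
  qed
qed

text \<open>
  The size condition on \<open>X\<close> turns a congruence between sums of inverses into an equality of
  rational numbers, which determines the set of primes occurring in the sums.
\<close>

lemma energy_inverses_of_primes_le:
  assumes "finite S" "k > 0" "k * X ^ (2 * k - 1) < q"
    and S: "\<And>s. s \<in> S \<Longrightarrow> prime s \<and> k < s \<and> s \<le> X"
    and inv: "\<And>s. s \<in> S \<Longrightarrow> [int s * \<psi> s = 1] (mod int q)"
  shows "energy q (lists_of S k) (\<lambda>xs. sum_list (map \<psi> xs)) \<le> k ^ k * card S ^ k"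
proof -
  let ?L = "lists_of S k"
  \<comment> \<open>These products are the two sides of the congruence after clearing denominators.
    A numerator of degree \<open>k - 1\<close> times a denominator of degree \<open>k\<close> gives
    the exponent \<open>2 * k - 1\<close>.\<close>
  have bound: "recip_num xs * prod_list ys < q" if "xs \<in> ?L" "ys \<in> ?L" for xs ys
  proof -
    have "recip_num xs \<le> k * X ^ (k - 1)" "prod_list ys \<le> X ^ k"
      using that S recip_num_le[of xs X] prod_list_le_power[of ys X]
      by (auto simp: lists_of_def subset_eq)
    then have "recip_num xs * prod_list ys \<le> k * X ^ (k - 1) * X ^ k"
      by (intro mult_le_mono)
    also have "\<dots> = k * X ^ (2 * k - 1)"
    proof -
      have "2 * k - 1 = (k - 1) + k" by simp
      then show ?thesis by (simp only: power_add mult_ac)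
    qed
    finally show ?thesis
      using assms(3) by simp
  qed
  have sub: "set ys \<subseteq> set xs"
    if "xs \<in> ?L" "ys \<in> ?L" "[sum_list (map \<psi> xs) = sum_list (map \<psi> ys)] (mod int q)" for xs ys
  proof (rule sum_list_recip_primes_eq_imp_subset)
    show "prime x \<and> length ys < x" if "x \<in> set xs \<union> set ys" for x
      using that \<open>xs \<in> ?L\<close> \<open>ys \<in> ?L\<close> S by (auto simp: lists_of_def)
    have inv': "[int s * \<psi> s = 1] (mod int q)" if "s \<in> set xs \<union> set ys" for s
      using that \<open>xs \<in> ?L\<close> \<open>ys \<in> ?L\<close> inv by (auto simp: lists_of_def)
    have "[int (recip_num xs) * int (prod_list ys) =
        (int (prod_list xs) * sum_list (map \<psi> xs)) * int (prod_list ys)] (mod int q)"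
      using inv' by (intro cong_mult cong_refl recip_num_cong) auto
    also have "[(int (prod_list xs) * sum_list (map \<psi> xs)) * int (prod_list ys) =
        (int (prod_list xs) * sum_list (map \<psi> ys)) * int (prod_list ys)] (mod int q)"
      using that(3) by (intro cong_mult cong_refl)
    also have "(int (prod_list xs) * sum_list (map \<psi> ys)) * int (prod_list ys) =
        (int (prod_list ys) * sum_list (map \<psi> ys)) * int (prod_list xs)"
      by (simp add: mult_ac)
    also have "[\<dots> = int (recip_num ys) * int (prod_list xs)] (mod int q)"
      using inv' by (intro cong_mult cong_refl cong_sym[OF recip_num_cong]) auto
    finally have "[recip_num xs * prod_list ys = recip_num ys * prod_list xs] (mod q)"
      by (simp flip: cong_int_iff)
    then have "recip_num xs * prod_list ys = recip_num ys * prod_list xs"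
      using bound that by (simp add: cong_def)
    then have "real (recip_num xs) * real (prod_list ys) = real (recip_num ys) * real (prod_list xs)"
      by (simp flip: of_nat_mult)
    moreover have nz: "0 \<notin> set xs" "0 \<notin> set ys"
      using that S by (auto simp: lists_of_def)
    ultimately show "(\<Sum>x\<leftarrow>xs. 1 / real x) = (\<Sum>y\<leftarrow>ys. 1 / real y)"
      by (simp add: sum_list_recip prod_list_zero_iff field_simps)
  qed
  \<comment> \<open>For each \<open>xs\<close>, every admissible \<open>ys\<close> takes its entries
    from the at most \<open>k\<close> elements of \<open>set xs\<close>, which leaves at most
    \<open>k ^ k\<close> choices.\<close>
  have "energy q ?L (\<lambda>xs. sum_list (map \<psi> xs)) \<le> card (SIGMA xs:?L. lists_of (set xs) k)"
    unfolding energy_def using assms(1) sub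
    by (intro card_mono finite_SigmaI finite_lists_of) (auto simp: lists_of_def)
  also have "\<dots> = (\<Sum>xs\<in>?L. card (set xs) ^ k)"
    using assms(1) by (simp add: card_SigmaI card_lists_of)
  also have "\<dots> \<le> (\<Sum>xs\<in>?L. k ^ k)"
    by (intro sum_mono power_mono) (auto simp: lists_of_def card_length)
  finally show ?thesis
    using assms(1) by (simp add: card_lists_of mult.commute)
qed

text \<open>The near-diagonal energy bound is inserted. With \<open>card S ^ (2 * k)\<close> moved
  to the left, the power of \<open>card S\<close> on the right is that of the trivial bound
  \<open>(card S)\<^sup>2\<close>, so the saving is \<open>card S ^ (2 * k)\<close> against
  \<open>k ^ (2 * k) * q\<close>.\<close>

lemma bilinear_inverses_of_primes_le:
  assumes "finite S" "k > 0" "k * X ^ (2 * k - 1) < q" "coprime h (int q)"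
    and S: "\<And>s. s \<in> S \<Longrightarrow> prime s \<and> k < s \<and> s \<le> X"
    and inv: "\<And>s. s \<in> S \<Longrightarrow> [int s * \<psi> s = 1] (mod int q)"
  shows "norm (\<Sum>r\<in>S. \<Sum>s\<in>S. add_char q (h * \<psi> r * \<psi> s)) ^ (2 * k\<^sup>2) * real (card S) ^ (2 * k)
    \<le> real k ^ (2 * k) * real q * real (card S) ^ (4 * k\<^sup>2)"
proof -
  let ?n = "real (card S)"
  have "norm (\<Sum>r\<in>S. \<Sum>s\<in>S. add_char q (h * \<psi> r * \<psi> s)) ^ (2 * k\<^sup>2)
      \<le> ?n ^ (4 * k * (k - 1)) * real q * real (energy q (lists_of S k) (\<lambda>xs. sum_list (map \<psi> xs))) ^ 2"
    using assms by (intro bilinear_sum_le_energy) auto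
  also have "\<dots> \<le> ?n ^ (4 * k * (k - 1)) * real q * (real k ^ k * ?n ^ k)\<^sup>2"
    using energy_inverses_of_primes_le[OF assms(1-3) S inv]
    by (intro mult_left_mono power_mono) (auto simp flip: of_nat_power of_nat_mult)
  finally have "norm (\<Sum>r\<in>S. \<Sum>s\<in>S. add_char q (h * \<psi> r * \<psi> s)) ^ (2 * k\<^sup>2) * ?n ^ (2 * k)
      \<le> ?n ^ (4 * k * (k - 1)) * real q * (real k ^ k * ?n ^ k)\<^sup>2 * ?n ^ (2 * k)"
    by (intro mult_right_mono) auto
  also have "\<dots> = real k ^ (2 * k) * real q * ?n ^ (4 * k * (k - 1) + 2 * k + 2 * k)"
  proof -
    have "(real k ^ k * ?n ^ k)\<^sup>2 = real k ^ (2 * k) * ?n ^ (2 * k)"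
      by (simp add: power_mult_distrib mult.commute flip: power_mult)
    then show ?thesis by (simp only: power_add mult_ac)
  qed
  also have "4 * k * (k - 1) + 2 * k + 2 * k = 4 * k\<^sup>2"
    using assms(2) by (cases k) (auto simp: power2_eq_square algebra_simps)
  finally show ?thesis .
qed

section \<open>Detecting the parity of inverses by characters\<close>

text \<open>
  Both characters have mean zero over \<open>m\<close> modulo \<open>q\<close>. Multiplication by \<open>Suc q div 2\<close>, the inverse
  of 2, turns the parity of \<open>m\<close> into the half of the circle that contains the character value; with
  \<open>s = sin (pi * m / q)\<close> the combination equals \<open>1 + 2 * s * (1 - s)\<close>.
\<close>

lemma char_combination_odd_ge_1:
  assumes "odd q" "0 \<le> m" "m \<le> int q" "odd m"
  shows "1 \<le> Re (add_char q m) - 2 * Im (add_char q (int (Suc q div 2) * m))"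
proof -
  have q: "q > 0" using assms(1) by (auto intro: gr0I)
  define \<theta> where "\<theta> = pi * of_int m / of_nat q"
  have \<theta>: "0 \<le> \<theta>" "\<theta> \<le> pi"
    using assms q by (auto simp: \<theta>_def field_simps)
  have "2 * real (Suc q div 2) = real q + 1"
    using assms(1) by (auto elim!: oddE)
  then have "2 * pi * of_int (int (Suc q div 2) * m) / of_nat q = \<theta> + pi * of_int m"
    using q by (simp add: \<theta>_def field_simps)
  then have "Im (add_char q (int (Suc q div 2) * m)) = sin (\<theta> + pi * of_int m)"
    by (simp only: add_char_def cis.sel)
  also have "\<dots> = - sin \<theta>"
    using assms(4) by (simp add: sin_add cos_npi_int)
  finally have im: "Im (add_char q (int (Suc q div 2) * m)) = - sin \<theta>" .
  have "Re (add_char q m) = cos (2 * \<theta>)"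
    by (simp add: add_char_def \<theta>_def mult.assoc)
  also have "\<dots> = 1 - 2 * (sin \<theta>)\<^sup>2"
    by (simp add: cos_double_sin)
  finally have re: "Re (add_char q m) = 1 - 2 * (sin \<theta>)\<^sup>2" .
  have "0 \<le> sin \<theta>" "sin \<theta> \<le> 1"
    using \<theta> by (auto intro: sin_ge_zero)
  then have "sin \<theta> * sin \<theta> \<le> sin \<theta> * 1"
    by (intro mult_left_mono)
  with re im show ?thesis
    by (simp add: power2_eq_square)
qed

text \<open>If all these residues are odd, the character combination is at least 1 on every pair, so
  a bilinear sum of comparable size to the trivial bound exists; the estimate for such sums then
  limits the number of primes.\<close>

lemma card_le_of_odd_inverses:
  assumes "finite S" "k > 0" "k * X ^ (2 * k - 1) < q" "odd q"
    and S: "\<And>s. s \<in> S \<Longrightarrow> prime s \<and> k < s \<and> s \<le> X"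
    and inv: "\<And>s. s \<in> S \<Longrightarrow> [int s * \<psi> s = 1] (mod int q)"
    and odd: "\<And>r s. r \<in> S \<Longrightarrow> s \<in> S \<Longrightarrow> odd ((\<psi> r * \<psi> s) mod int q)"
  shows "real (card S) ^ (2 * k) \<le> 9 ^ k\<^sup>2 * real k ^ (2 * k) * real q"
proof (cases "S = {}")
  case True
  then show ?thesis using assms(2) by (simp add: power_0_left)
next
  case False
  let ?n = "real (card S)"
  have n: "?n > 0" using False assms(1) by (simp add: card_gt_0_iff)
  have q: "q > 0" using assms(3) by simp
  define t where "t = int (Suc q div 2)"
  define T where "T h = (\<Sum>r\<in>S. \<Sum>s\<in>S. add_char q (h * \<psi> r * \<psi> s))" for h
  have "?n\<^sup>2 = (\<Sum>r\<in>S. \<Sum>s\<in>S. 1)"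
    by (simp add: power2_eq_square)
  also have "\<dots> \<le> (\<Sum>r\<in>S. \<Sum>s\<in>S. Re (add_char q (1 * \<psi> r * \<psi> s)) - 2 * Im (add_char q (t * \<psi> r * \<psi> s)))"
  proof (intro sum_mono)
    fix r s assume rs: "r \<in> S" "s \<in> S"
    define m where "m = (\<psi> r * \<psi> s) mod int q"
    have "add_char q (h * m) = add_char q (h * \<psi> r * \<psi> s)" for h
      unfolding m_def using q by (intro add_char_cong) (simp_all add: cong_def mod_mult_right_eq mult.assoc)
    from this[of 1] this[of t]
    show "1 \<le> Re (add_char q (1 * \<psi> r * \<psi> s)) - 2 * Im (add_char q (t * \<psi> r * \<psi> s))"
      using char_combination_odd_ge_1[of q m] assms(4) odd[OF rs] q
      by (simp add: m_def t_def less_imp_le)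
  qed
  also have "\<dots> = Re (T 1) - 2 * Im (T t)"
    by (simp add: T_def sum_subtractf Re_sum Im_sum sum_distrib_left)
  also have "\<dots> \<le> norm (T 1) + 2 * norm (T t)"
    using complex_Re_le_cmod[of "T 1"] abs_Im_le_cmod[of "T t"] by linarith
  \<comment> \<open>The weights 1 and 2 add up to 3, so the norms cannot both lie below a third of
    the trivial bound. Raised to the power \<open>2 * k\<^sup>2\<close>, the 3 becomes
    \<open>9 ^ k\<^sup>2\<close>.\<close>
  finally have "norm (T 1) \<ge> ?n\<^sup>2 / 3 \<or> norm (T t) \<ge> ?n\<^sup>2 / 3"
    by linarith
  moreover have "coprime t (int q)"
  proof -
    have "2 * t - int q = 1"
      using assms(4) by (auto simp: t_def elim!: oddE)
    then show ?thesis
      by (metis coprimeI dvd_diff dvd_mult)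
  qed
  ultimately obtain h where h: "coprime h (int q)" "norm (T h) \<ge> ?n\<^sup>2 / 3"
    by (metis coprime_1_left)
  have "(?n\<^sup>2 / 3) ^ (2 * k\<^sup>2) * ?n ^ (2 * k) \<le> norm (T h) ^ (2 * k\<^sup>2) * ?n ^ (2 * k)"
    using h(2) by (intro mult_right_mono power_mono) auto
  also have "\<dots> \<le> real k ^ (2 * k) * real q * ?n ^ (4 * k\<^sup>2)"
    unfolding T_def using assms h(1) by (intro bilinear_inverses_of_primes_le) auto
  also have "(?n\<^sup>2 / 3) ^ (2 * k\<^sup>2) = ?n ^ (4 * k\<^sup>2) / 9 ^ k\<^sup>2"
    by (simp add: power_divide flip: power_mult) (simp add: power_mult)
  finally have "?n ^ (2 * k) * ?n ^ (4 * k\<^sup>2) \<le> 9 ^ k\<^sup>2 * real k ^ (2 * k) * real q * ?n ^ (4 * k\<^sup>2)"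
    by (simp add: field_simps)
  then show ?thesis
    using n by simp
qed

section \<open>Chebyshev's lower bound for the number of primes\<close>

text \<open>
  The factorial quotient is the Beta integral of \<open>x ^ a * (1 - x) ^ b\<close> over the unit interval, an
  integer combination of the fractions \<open>1 / i\<close>.
\<close>

lemma beta_recurrence_Ints:
  assumes "\<And>i. i \<in> {1..n} \<Longrightarrow> i dvd L" "a + b < n"
  shows "real L * fact a * fact b / fact (a + b + 1) \<in> \<int>"
  using assms(2)
proof (induction b arbitrary: a)
  case 0
  then have "Suc a dvd L"
    using assms(1) by simp
  then obtain c where "L = Suc a * c" by blast
  then have "real L = real (Suc a) * real c"
    by (simp only: of_nat_mult)
  then have "real L * fact a * fact 0 / fact (a + 0 + 1) = real c"
    by (simp add: divide_eq_eq mult_ac del: of_nat_Suc)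
  then show ?case by simp
next
  case (Suc b)
  \<comment> \<open>Integrated form of \<open>x ^ a * (1 - x) ^ Suc b = x ^ a * (1 - x) ^ b - x ^
    Suc a * (1 - x) ^ b\<close>.\<close>
  have "real L * fact a * fact (Suc b) / fact (a + Suc b + 1) =
      real L * fact a * fact b / fact (a + b + 1) -
      real L * fact (Suc a) * fact b / fact (Suc a + b + 1)"
    by (simp add: divide_simps) (simp add: algebra_simps)
  also have "\<dots> \<in> \<int>"
    using Suc.prems Suc.IH[of a] Suc.IH[of "Suc a"] by (intro Ints_diff) auto
  finally show ?case .
qed

text \<open>Nair's argument: at \<open>a = b = m\<close> the Beta integral is the reciprocal of
  \<open>2 * m + 1\<close> times the central binomial coefficient. Multiplied by \<open>L\<close> it
  is a positive integer, hence at least 1.\<close>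

lemma four_power_le_common_multiple:
  assumes "\<And>i. i \<in> {1..n} \<Longrightarrow> i dvd L" "L > 0" "2 * m < n"
  shows "4 ^ m \<le> L"
proof -
  let ?c = "(2 * m) choose m"
  have binom: "real ?c * (fact m * fact m) = fact (2 * m)"
    using binomial_fact[of m "2 * m", where ?'a = real] by simp
  have c: "real ?c > 0"
    by simp
  have "real L * fact m * fact m / fact (m + m + 1) \<in> \<int>"
    using assms(3) by (intro beta_recurrence_Ints[OF assms(1)]) (simp_all add: mult_2)
  also have "real L * fact m * fact m / fact (m + m + 1) = real L / (real (2 * m + 1) * real ?c)"
  proof -
    have "fact (m + m + 1) = real (2 * m + 1) * (real ?c * (fact m * fact m))"
    proof -
      have "m + m + 1 = Suc (2 * m)" by simp
      then show ?thesis
        unfolding binom by (simp only: fact_Suc) simp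
    qed
    then show ?thesis by simp
  qed
  finally obtain z where z: "real L / (real (2 * m + 1) * real ?c) = of_int z"
    by (elim Ints_cases)
  have pos: "real (2 * m + 1) * real ?c > 0"
    using c by (intro mult_pos_pos) auto
  then have "real L / (real (2 * m + 1) * real ?c) > 0"
    using assms(2) by (intro divide_pos_pos) auto
  then have "1 \<le> real_of_int z"
    unfolding z by simp
  then have "real (2 * m + 1) * real ?c \<le> real L"
    using pos unfolding z[symmetric] by (simp only: le_divide_eq_1_pos)
  moreover have "4 ^ m \<le> real (2 * m + 1) * real ?c"
  \<comment> \<open>The lower bound for the central binomial coefficient has \<open>2 * m\<close> in
    its denominator.\<close>
  proof (cases "m = 0")
    case False
    then have "4 ^ m \<le> 2 * real m * real ?c"
      using central_binomial_lower_bound[of m] by (simp add: field_simps)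
    also have "\<dots> \<le> real (2 * m + 1) * real ?c"
      by (intro mult_right_mono) auto
    finally show ?thesis .
  qed simp
  ultimately have "4 ^ m \<le> real L" by linarith
  then have "real (4 ^ m) \<le> real L" by (simp only: of_nat_power of_nat_numeral)
  then show ?thesis by (simp only: of_nat_le_iff)
qed

text \<open>Bounds the least common multiple of \<open>1, ..., n\<close> from both sides: it is the
  product of one prime power \<open>p ^ M p\<close>, itself at most \<open>n\<close>, for each prime
  up to \<open>n\<close>.\<close>

lemma two_power_le_power_prime_count:
  assumes "n > 0"
  shows "2 ^ n \<le> 4 * n ^ card {p. prime p \<and> p \<le> n}"
proof -
  let ?P = "{p::nat. prime p \<and> p \<le> n}"
  define M where "M p = Max (multiplicity p ` {1..n})" for p
  define L where "L = (\<Prod>p\<in>?P. p ^ M p)"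
  have fin: "finite ?P" by simp
  have "L > 0"
    unfolding L_def by (intro prod_pos) (auto intro: prime_gt_0_nat)
  have dvd: "i dvd L" if "i \<in> {1..n}" for i
  proof -
    have "i = (\<Prod>p\<in>prime_factors i. p ^ multiplicity p i)"
      using that by (simp add: prod_prime_factors)
    also have "\<dots> dvd L"
      unfolding L_def
    proof (rule prod_dvd_prod_subset2)
      show "prime_factors i \<subseteq> ?P"
        using that by (auto simp: prime_factors_dvd dest!: dvd_imp_le)
      show "p ^ multiplicity p i dvd p ^ M p" for p
        unfolding M_def using that by (intro le_imp_power_dvd Max_ge) auto
    qed (rule fin)
    finally show ?thesis .
  qed
  have "p ^ M p \<le> n" for p
  proof -
    have "M p \<in> multiplicity p ` {1..n}"
      unfolding M_def using assms by (intro Max_in) auto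
    then obtain i where "i \<in> {1..n}" "M p = multiplicity p i" by auto
    then show ?thesis
      using dvd_imp_le[OF multiplicity_dvd[of p i]] by simp
  qed
  then have "L \<le> (\<Prod>p\<in>?P. n)"
    unfolding L_def by (intro prod_mono) auto
  then have "L \<le> n ^ card ?P" by simp
  moreover have "4 ^ ((n - 1) div 2) \<le> L"
    using dvd \<open>L > 0\<close> assms by (intro four_power_le_common_multiple[of n]) auto
  \<comment> \<open>The factor 4 makes up for the rounding in \<open>(n - 1) div 2\<close>.\<close>
  moreover have "(2::nat) ^ n \<le> 4 * 4 ^ ((n - 1) div 2)"
  proof -
    have "(2::nat) ^ n \<le> 2 ^ (2 + 2 * ((n - 1) div 2))"
      using assms by (intro power_increasing) auto
    also have "\<dots> = 4 * 4 ^ ((n - 1) div 2)"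
      by (simp add: power_add power_mult)
    finally show ?thesis .
  qed
  ultimately show ?thesis by linarith
qed

lemma prime_count_ge:
  assumes "n \<ge> 2"
  shows "(real n - 2) * ln 2 / ln (real n) \<le> real (card {p. prime p \<and> p \<le> n})"
proof -
  let ?c = "card {p. prime p \<and> p \<le> n}"
  have "real (2 ^ n) \<le> real (4 * n ^ ?c)"
    using two_power_le_power_prime_count[of n] assms by (simp only: of_nat_le_iff)
  then have "ln (2 ^ n) \<le> ln (4 * real n ^ ?c)"
    using assms by simp
  also have "\<dots> = 2 * ln 2 + real ?c * ln (real n)"
    using assms ln_realpow[of 2 2] by (simp add: ln_mult ln_realpow)
  finally have "(real n - 2) * ln 2 \<le> real ?c * ln (real n)"
    by (simp add: ln_realpow algebra_simps)
  then show ?thesis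
    using assms by (simp add: divide_le_eq)
qed

section \<open>Comparing the number of available primes with \<open>q\<close>\<close>

text \<open>Each distinct prime factor contributes at least 2. Hence only logarithmically many
  primes are lost when those dividing \<open>q\<close> are discarded.\<close>

lemma two_power_card_prime_factors_le:
  fixes q :: nat
  assumes "q > 0"
  shows "2 ^ card (prime_factors q) \<le> q"
proof -
  have "2 ^ card (prime_factors q) = (\<Prod>p\<in>prime_factors q. 2)"
    by simp
  also have "\<dots> \<le> (\<Prod>p\<in>prime_factors q. p ^ multiplicity p q)"
  proof (intro prod_mono conjI)
    fix p assume p: "p \<in> prime_factors q"
    then have "prime p" "multiplicity p q > 0"
      by (auto simp: prime_factors_multiplicity)
    then have "p ^ 1 \<le> p ^ multiplicity p q"
      by (intro power_increasing) (auto dest: prime_gt_0_nat)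
    then show "2 \<le> p ^ multiplicity p q"
      using \<open>prime p\<close> by (auto dest: prime_ge_2_nat)
  qed simp
  also have "\<dots> = q"
    using assms by (simp add: prod_prime_factors)
  finally show ?thesis .
qed

text \<open>The expression in parentheses is asymptotic to \<open>ln 2 * x / ln x\<close>, so its
  \<open>2 * k\<close>-th power exceeds \<open>x ^ (2 * k - 1)\<close> by a factor \<open>x\<close>
  up to logarithms. \<open>A\<close> and \<open>B\<close> make room for excluded primes.\<close>

lemma eventually_prime_count_bound_large:
  fixes A B C :: real
  assumes "k > 0"
  shows "eventually (\<lambda>x::real. 0 \<le> (x - 2) * ln 2 / ln x - A - B * ln x \<and>
           C * x ^ (2 * k - 1) < ((x - 2) * ln 2 / ln x - A - B * ln x) ^ (2 * k)) at_top"
proof -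
  have 1: "eventually (\<lambda>x::real. x / (4 * ln x) \<le> (x - 2) * ln 2 / ln x - A - B * ln x) at_top"
  proof -
    have "((\<lambda>x::real. ((x - 2) * ln 2 / ln x - A - B * ln x) / (x / ln x)) \<longlongrightarrow> ln 2) at_top"
      by real_asymp
    \<comment> \<open>Any positive constant below \<open>ln 2\<close> serves;
      \<open>ln (1 / 2) \<le> - 1 / 2\<close> gives \<open>ln 2 \<ge> 1 / 2\<close>.\<close>
    moreover have "1 / 4 < ln (2::real)"
      using ln_le_minus_one[of "1 / 2 :: real"] by (simp add: ln_div)
    ultimately have "eventually (\<lambda>x. 1 / 4 < ((x - 2) * ln 2 / ln x - A - B * ln x) / (x / ln x)) at_top"
      by (rule order_tendstoD)
    then show ?thesis
      using eventually_gt_at_top[of 1]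
    proof eventually_elim
      case (elim x)
      then have "x / ln x > 0" by simp
      then have "1 / 4 * (x / ln x) < (x - 2) * ln 2 / ln x - A - B * ln x"
        using elim(1) by (simp only: less_divide_eq if_True)
      then show ?case by simp
    qed
  qed
  have "((\<lambda>x. ln x ^ (2 * k) / exp (ln x)) \<longlongrightarrow> (0::real)) at_top"
    by (rule filterlim_compose[OF tendsto_power_div_exp_0 ln_at_top])
  then have "((\<lambda>x. (C * 4 ^ (2 * k)) * (ln x ^ (2 * k) / exp (ln x))) \<longlongrightarrow> (C * 4 ^ (2 * k)) * 0) at_top"
    by (intro tendsto_intros)
  then have 2: "eventually (\<lambda>x::real. (C * 4 ^ (2 * k)) * (ln x ^ (2 * k) / exp (ln x)) < 1) at_top"
    by (rule order_tendstoD) simp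
  show ?thesis
    using 1 2 eventually_gt_at_top[of 1]
  proof eventually_elim
    case (elim x)
    have ln: "ln x > 0" using elim by simp
    have "C * 4 ^ (2 * k) * ln x ^ (2 * k) < x"
      using elim by (simp add: field_simps)
    then have "C * 4 ^ (2 * k) * ln x ^ (2 * k) * x ^ (2 * k - 1) < x * x ^ (2 * k - 1)"
      using elim by (intro mult_strict_right_mono) auto
    also have "x * x ^ (2 * k - 1) = x ^ (2 * k)"
      using assms by (cases k) auto
    finally have "C * x ^ (2 * k - 1) < (x / (4 * ln x)) ^ (2 * k)"
      using ln by (simp add: power_divide power_mult_distrib field_simps)
    also have "\<dots> \<le> ((x - 2) * ln 2 / ln x - A - B * ln x) ^ (2 * k)"
      using elim ln by (intro power_mono) auto
    finally have "C * x ^ (2 * k - 1) < ((x - 2) * ln 2 / ln x - A - B * ln x) ^ (2 * k)" .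
    moreover have "0 \<le> x / (4 * ln x)"
      using elim(3) ln by (intro divide_nonneg_nonneg) auto
    then have "0 \<le> (x - 2) * ln 2 / ln x - A - B * ln x"
      using elim(1) by (rule order_trans)
    ultimately show ?case by blast
  qed
qed

section \<open>Small products of two primes with even inverse\<close>

lemma inv_residue_eqI:
  assumes "q > 1" "[a * b = 1] (mod q)"
  shows "inv_residue q a = b mod q"
proof -
  have cop: "coprime a q"
    using assms(2) coprime_iff_invertible_int by blast
  have "[a * (b mod q) = 1] (mod q)"
    using assms(2) by (simp add: cong_def mod_mult_right_eq)
  then have "[a * inv_residue q a = a * (b mod q)] (mod q)"
    using inv_residue_props(3)[OF assms(1) cop] cong_sym cong_trans by blast
  then have "[inv_residue q a = b mod q] (mod q)"
    using cop by (simp add: cong_mult_lcancel)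
  then show ?thesis
    using inv_residue_props(1,2)[OF assms(1) cop] by (simp add: cong_def)
qed

text \<open>\<open>X\<close> is one less than the least \<open>Y\<close> with
  \<open>q \<le> k * Y ^ e\<close>; as \<open>k < q\<close> forces \<open>Y \<ge> 2\<close>, also
  \<open>Y \<le> 2 * X\<close>. The bound below \<open>q\<close> is the size condition for the
  energy estimate, the other keeps \<open>X\<close> of order \<open>q powr (1 / e)\<close>.\<close>

lemma exists_power_bracket:
  fixes k e q :: nat
  assumes "e > 0" "k > 0" "k < q"
  obtains X where "X > 0" "k * X ^ e < q" "q \<le> k * (2 * X) ^ e"
proof -
  define Y where "Y = (LEAST Y. q \<le> k * Y ^ e)"
  \<comment> \<open>\<open>q\<close> itself satisfies the inequality, so a least such number
    exists.\<close>
  have "q \<le> q ^ e"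
    using assms by (simp add: self_le_power)
  also have "\<dots> \<le> k * q ^ e"
    using assms by simp
  finally have Y: "q \<le> k * Y ^ e"
    unfolding Y_def by (rule LeastI)
  have "Y \<noteq> 0"
  proof
    assume "Y = 0"
    with Y assms show False by (simp add: power_0_left)
  qed
  have "Y \<noteq> 1"
  proof
    assume "Y = 1"
    with Y assms show False by simp
  qed
  show thesis
  proof
    show "Y - 1 > 0"
      using \<open>Y \<noteq> 0\<close> \<open>Y \<noteq> 1\<close> by simp
    have "\<not> q \<le> k * (Y - 1) ^ e"
      unfolding Y_def by (rule not_less_Least) (use \<open>Y \<noteq> 0\<close> in \<open>simp add: Y_def\<close>)
    then show "k * (Y - 1) ^ e < q" by simp
    have "Y \<le> 2 * (Y - 1)"
      using \<open>Y \<noteq> 0\<close> \<open>Y \<noteq> 1\<close> by simp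
    then have "k * Y ^ e \<le> k * (2 * (Y - 1)) ^ e"
      by (intro mult_left_mono power_mono) auto
    with Y show "q \<le> k * (2 * (Y - 1)) ^ e" by (rule order_trans)
  qed
qed

text \<open>Too few primes are allowed if all products of two have odd inverses, and Chebyshev's
  bound supplies more. \<open>X\<close> stays in the conclusion so that
  \<open>a \<le> X\<^sup>2\<close> can be turned into a power of \<open>q\<close>;
  \<open>k \<ge> 2\<close> makes the primes above \<open>k\<close> odd.\<close>

lemma exists_small_prime_product_even_inverse:
  assumes k: "k \<ge> 2"
  shows "\<exists>N. \<forall>q>N. odd q \<longrightarrow>
    (\<exists>a X. X ^ (2 * k - 1) < q \<and> 0 < a \<and> a \<le> X\<^sup>2 \<and> odd a \<and> coprime a q \<and>
       even (inv_residue (int q) (int a)))"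
proof -
  define e where "e = 2 * k - 1"
  \<comment> \<open>The bracket for \<open>q\<close> will give
    \<open>q \<le> K * X ^ e\<close>.\<close>
  define K where "K = k * 2 ^ e"
  define D where "D = 9 ^ k\<^sup>2 * real k ^ (2 * k)"
  \<comment> \<open>Lower bound for the number of usable primes up to \<open>x\<close>: Chebyshev's
    bound, less \<open>k\<close> for the primes up to \<open>k\<close>, less the base 2 logarithm of
    \<open>K * x ^ e\<close> for the prime factors of \<open>q\<close>.\<close>
  define f where "f x = (x - 2) * ln 2 / ln x - (real k + ln K / ln 2) - real e / ln 2 * ln x" for x :: real
  have "e > 0" "k > 0" "K > 0"
    using k by (simp_all add: e_def K_def)
  have "eventually (\<lambda>x. 0 \<le> f x \<and> (D * real K) * x ^ e < f x ^ (2 * k)) at_top"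
    unfolding f_def e_def using \<open>k > 0\<close> by (rule eventually_prime_count_bound_large)
  then obtain x0 where x0: "\<And>x. x \<ge> x0 \<Longrightarrow> 0 \<le> f x \<and> (D * real K) * x ^ e < f x ^ (2 * k)"
    by (auto simp: eventually_at_top_linorder)
  define N where "N = max 2 (nat \<lceil>x0\<rceil>)"
  show ?thesis
  \<comment> \<open>Since \<open>q \<le> K * X ^ e\<close>, this threshold forces
    \<open>X > N\<close>, where the asymptotic comparison is valid.\<close>
  proof (rule exI[of _ "K * N ^ e"], intro allI impI)
    fix q assume q: "q > K * N ^ e" "odd q"
    have "k \<le> K * N ^ e"
      by (simp add: K_def N_def)
    with q have "k < q" by simp
    then obtain X where X: "X > 0" "k * X ^ e < q" "q \<le> k * (2 * X) ^ e"
      using exists_power_bracket \<open>e > 0\<close> \<open>k > 0\<close> by blast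
    have qX: "q \<le> K * X ^ e"
      using X(3) by (simp add: K_def power_mult_distrib mult_ac)
    have "X > N"
    proof (rule ccontr)
      assume "\<not> X > N"
      then have "K * X ^ e \<le> K * N ^ e"
        by (intro mult_left_mono power_mono) auto
      with qX q show False by simp
    qed
    then have "X \<ge> 2" "real X \<ge> x0"
      by (auto simp: N_def) linarith
    \<comment> \<open>Primes up to \<open>k\<close> are removed for the comparison of sums of
      \<open>k\<close> reciprocals, prime factors of \<open>q\<close> for invertibility.\<close>
    define S where "S = {p. prime p \<and> p \<le> X} - {..k} - prime_factors q"
    have S: "prime s" "k < s" "s \<le> X" "coprime s q" if "s \<in> S" for s
      using that \<open>k < q\<close> by (auto simp: S_def prime_factors_dvd intro!: prime_imp_coprime)
    have "finite S" by (simp add: S_def)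
    have card: "f (real X) \<le> real (card S)"
    proof -
      have "card {p. prime p \<and> p \<le> X} \<le> card (S \<union> {1..k} \<union> prime_factors q)"
        using \<open>finite S\<close> by (intro card_mono) (auto simp: S_def prime_gt_0_nat Suc_leI)
      also have "\<dots> \<le> card S + k + card (prime_factors q)"
        by (intro order_trans[OF card_Un_le] add_mono) (auto intro: order_trans[OF card_Un_le])
      finally have "real (card {p. prime p \<and> p \<le> X}) \<le> real (card S) + real k + real (card (prime_factors q))"
        by linarith
      moreover have "real (card (prime_factors q)) \<le> ln K / ln 2 + real e / ln 2 * ln X"
      proof -
        have "2 ^ card (prime_factors q) \<le> K * X ^ e"
          using two_power_card_prime_factors_le[of q] \<open>k < q\<close> qX by linarith
        then have "real (2 ^ card (prime_factors q)) \<le> real (K * X ^ e)"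
          by (simp only: of_nat_le_iff)
        then have "ln (2 ^ card (prime_factors q)) \<le> ln (real K * real X ^ e)"
          using \<open>K > 0\<close> \<open>X > 0\<close> by simp
        then have "card (prime_factors q) * ln 2 \<le> ln (real K) + e * ln (real X)"
          using \<open>K > 0\<close> \<open>X > 0\<close> by (simp add: ln_mult ln_realpow)
        then show ?thesis
          by (simp add: field_simps)
      qed
      ultimately show ?thesis
        using prime_count_ge[OF \<open>X \<ge> 2\<close>] by (simp add: f_def)
    qed
    have "\<exists>b. [int s * b = 1] (mod int q)" if "s \<in> S" for s
      using S(4)[OF that] by (intro cong_solve_coprime_int) simp
    then obtain \<psi> where \<psi>: "\<And>s. s \<in> S \<Longrightarrow> [int s * \<psi> s = 1] (mod int q)"
      by metis
    have "\<exists>r\<in>S. \<exists>s\<in>S. even ((\<psi> r * \<psi> s) mod int q)"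
    proof (rule ccontr)
      assume "\<not> ?thesis"
      then have "real (card S) ^ (2 * k) \<le> D * real q"
        unfolding D_def using \<open>finite S\<close> \<open>k > 0\<close> X(2) q(2) S \<psi>
        by (intro card_le_of_odd_inverses[where X = X and \<psi> = \<psi>]) (auto simp: e_def)
      also have "\<dots> \<le> D * real (K * X ^ e)"
        using qX by (intro mult_left_mono) (auto simp: D_def simp del: of_nat_mult)
      also have "\<dots> < f (real X) ^ (2 * k)"
        using x0[OF \<open>real X \<ge> x0\<close>] by simp
      also have "\<dots> \<le> real (card S) ^ (2 * k)"
        using card x0[OF \<open>real X \<ge> x0\<close>] by (intro power_mono) auto
      finally show False by simp
    qed
    then obtain r s where rs: "r \<in> S" "s \<in> S" "even ((\<psi> r * \<psi> s) mod int q)"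
      by blast
    have "[(int r * \<psi> r) * (int s * \<psi> s) = 1 * 1] (mod int q)"
      using rs \<psi> by (intro cong_mult) auto
    then have "inv_residue (int q) (int (r * s)) = (\<psi> r * \<psi> s) mod int q"
      using \<open>k < q\<close> k by (intro inv_residue_eqI) (simp_all add: mult_ac)
    moreover have "odd s" if "s \<in> S" for s
      using S[OF that] k prime_odd_nat by auto
    moreover have "1 * X ^ e \<le> k * X ^ e"
      using \<open>k > 0\<close> by (intro mult_le_mono1) simp
    then have "X ^ e < q"
      using X(2) by linarith
    ultimately show "\<exists>a X. X ^ (2 * k - 1) < q \<and> 0 < a \<and> a \<le> X\<^sup>2 \<and> odd a \<and> coprime a q \<and>
        even (inv_residue (int q) (int a))"
      using rs S[OF rs(1)] S[OF rs(2)]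
      by (intro exI[of _ "r * s"] exI[of _ X])
         (auto simp: e_def power2_eq_square prime_gt_0_nat intro!: mult_le_mono)
  qed
qed

section \<open>Choice of \<open>k\<close> in terms of \<open>\<epsilon>\<close>, and small
  moduli\<close>

theorem corollary1:
  shows "\<forall>\<epsilon>::real. \<epsilon> > 0 \<longrightarrow>
    (\<exists>(\<eta>::real) (C::real). \<eta> > 0 \<and> C > 0 \<and>
      (\<forall>q::int. q > 1 \<and> odd q \<and> squarefree q \<and>
          (\<forall>p. prime p \<and> p dvd q \<longrightarrow> real_of_int p \<le> real_of_int q powr \<eta>) \<longrightarrow>
        (\<exists>a::int. 1 \<le> a \<and> real_of_int a \<le> C * real_of_int q powr \<epsilon> \<and>
          coprime a q \<and> \<not> 2 dvd (a + inv_residue q a))))"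
proof (intro allI impI)
  fix \<epsilon> :: real assume "\<epsilon> > 0"
  \<comment> \<open>With \<open>e = 2 * k - 1 \<ge> k\<close> this gives
    \<open>2 / e \<le> \<epsilon>\<close>, where \<open>2 / e\<close> is the exponent of
    \<open>q\<close> in the bound for \<open>X\<^sup>2\<close>.\<close>
  define k where "k = max 2 (nat \<lceil>2 / \<epsilon>\<rceil>)"
  define e where "e = 2 * k - 1"
  have k: "k \<ge> 2" "real k \<ge> 2 / \<epsilon>"
    by (simp_all add: k_def) linarith
  have e: "real e > 0" "real e \<ge> real k"
    using k by (auto simp: e_def)
  with k(2) have "2 / \<epsilon> \<le> real e" by linarith
  then have e\<epsilon>: "2 / real e \<le> \<epsilon>"
    using e(1) \<open>\<epsilon> > 0\<close> by (simp add: field_simps)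
  obtain N where N: "\<And>q. q > N \<Longrightarrow> odd q \<Longrightarrow>
    \<exists>a X. X ^ e < q \<and> 0 < a \<and> a \<le> X\<^sup>2 \<and> odd a \<and> coprime a q \<and> even (inv_residue (int q) (int a))"
    using exists_small_prime_product_even_inverse[OF k(1)] unfolding e_def by blast
  have "\<exists>a::int. 1 \<le> a \<and> real_of_int a \<le> (real N + 1) * real_of_int q powr \<epsilon> \<and>
      coprime a q \<and> \<not> 2 dvd (a + inv_residue q a)" if "q > 1" "odd q" for q :: int
  proof (cases "q \<le> int N")
    case True
    have "1 \<le> real_of_int q powr \<epsilon>"
      using that \<open>\<epsilon> > 0\<close> by (intro ge_one_powr_ge_zero) auto
    then have "(real N + 1) * 1 \<le> (real N + 1) * real_of_int q powr \<epsilon>"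
      by (intro mult_left_mono) auto
    moreover have "real_of_int (q + 1) \<le> (real N + 1) * 1"
      using True by simp
    ultimately have le: "real_of_int (q + 1) \<le> (real N + 1) * real_of_int q powr \<epsilon>"
      by (rule order_trans[rotated])
    \<comment> \<open>\<open>q + 1\<close> is congruent to 1, so the sum in question is
      \<open>q + 2\<close>, which is odd; the size of \<open>q + 1\<close> is absorbed by the
      constant \<open>N + 1\<close>.\<close>
    have "inv_residue q (q + 1) = 1 mod q"
      using that(1) by (intro inv_residue_eqI) (simp_all add: cong_def)
    then have "inv_residue q (q + 1) = 1"
      using that(1) by simp
    then have "\<not> 2 dvd (q + 1 + inv_residue q (q + 1))"
      using that(2) by simp
    moreover have "coprime (q + 1) q"
      by simp
    ultimately show ?thesis
      using that(1) le by (intro exI[of _ "q + 1"] conjI) linarith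
  next
    case False
    define n where "n = nat q"
    have n: "q = int n" "n > N" "odd n"
      using that False by (auto simp: n_def even_nat_iff)
    obtain a X where aX: "X ^ e < n" "0 < a" "a \<le> X\<^sup>2" "odd a" "coprime a n"
      "even (inv_residue (int n) (int a))"
      using N[OF n(2,3)] by blast
    have "X > 0"
      using aX by (auto intro: gr0I)
    have "real a \<le> real X ^ 2"
      using aX(3) by (simp flip: of_nat_power)
    \<comment> \<open>Rewritten as a power of \<open>X ^ e\<close>, the quantity known to be below
      \<open>n\<close>.\<close>
    also have "\<dots> = real (X ^ e) powr (2 / e)"
    proof -
      have "real (X ^ e) = real X powr real e"
        using \<open>X > 0\<close> by (simp add: powr_realpow)
      then have "real (X ^ e) powr (2 / e) = real X powr 2"
        using e(1) by (simp only: powr_powr) simp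
      then show ?thesis
        using \<open>X > 0\<close> by simp
    qed
    also have "\<dots> \<le> real n powr (2 / e)"
      using aX(1) by (intro powr_mono2) auto
    also have "\<dots> \<le> real n powr \<epsilon>"
      using e\<epsilon> aX(1) by (intro powr_mono) auto
    also have "\<dots> \<le> (real N + 1) * real n powr \<epsilon>"
      by (simp add: algebra_simps)
    finally show ?thesis
      using aX n(1) by (intro exI[of _ "int a"]) auto
  qed
  then show "\<exists>(\<eta>::real) (C::real). \<eta> > 0 \<and> C > 0 \<and>
      (\<forall>q::int. q > 1 \<and> odd q \<and> squarefree q \<and>
          (\<forall>p. prime p \<and> p dvd q \<longrightarrow> real_of_int p \<le> real_of_int q powr \<eta>) \<longrightarrow>
        (\<exists>a::int. 1 \<le> a \<and> real_of_int a \<le> C * real_of_int q powr \<epsilon> \<and>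
          coprime a q \<and> \<not> 2 dvd (a + inv_residue q a)))"
    by (intro exI[of _ 1] exI[of _ "real N + 1"]) auto
qed

end
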